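(* Let $\mathcal{G}$ denote the GHZ game and, for a positive integer $n$, let $\mathcal{G}^n$ denote its $n$-fold parallel repetition. Then $v(\mathcal{G}^n) \le n^{-\Omega(1)}$; that is, there exist constants $c > 0$ and $C > 0$ such that $v(\mathcal{G}^n) \le C\, n^{-c}$ for every positive integer $n$.
   Context: The GHZ game is a 3-player game. A question triple $x = (x_1,x_2,x_3)$ is drawn uniformly from $\mathcal{Q} = \{x \in \mathbb{F}_2^3 : x_1 + x_2 + x_3 = 0\}$; player $i$ receives $x_i$ and outputs an answer $y_i \in \mathbb{F}_2$; the players win iff $y_1 \oplus y_2 \oplus y_3 = x_1 \lor x_2 \lor x_3$. In the $n$-fold parallel repetition $\mathcal{G}^n$, question triples $x^{(1)},\dots,x^{(n)}$ are drawn independently from this distribution; player $i$ receives $(x^{(1)}_i,\dots,x^{(n)}_i) \in \mathbb{F}_2^n$ and outputs $(y^{(1)}_i,\dots,y^{(n)}_i) \in \mathbb{F}_2^n$ as a function of its input only (no communication); the players win iff they win the GHZ game in every coordinate $t \in [n]$. The value $v(\mathcal{G}^n)$ is the maximum, over all strategies (functions $f_i : \mathbb{F}_2^n \to \mathbb{F}_2^n$, $i=1,2,3$), of the winning probability. (The value of the GHZ game itself is $3/4$.) *)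

theory Defs
  imports "HOL-Library.Z2" "HOL-Probability.Probability"
begin

text \<open>The type \<^typ>\<open>bit\<close> of theory Z2 is the field with two elements; its addition is exclusive or.\<close>

type_synonym bit3 = "bit \<times> bit \<times> bit"

definition ghz_questions :: "bit3 set" where
  "ghz_questions = {(x1, x2, x3). x1 + x2 + x3 = 0}"

definition ghz_wins :: "bit3 \<Rightarrow> bit3 \<Rightarrow> bool" where
  "ghz_wins = (\<lambda>(x1, x2, x3) (y1, y2, y3).
     y1 + y2 + y3 = of_bool (x1 = 1 \<or> x2 = 1 \<or> x3 = 1))"

text \<open>
  The dimension \<open>n\<close> varies inside the asymptotic statement, so an element of the \<open>n\<close>-dimensional
  space over the two-element field is a function on \<^typ>\<open>nat\<close> that vanishes outside \<open>{..<n}\<close>.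
\<close>

definition bitvecs :: "nat \<Rightarrow> (nat \<Rightarrow> bit) set" where
  "bitvecs n = {v. \<forall>t\<ge>n. v t = 0}"

text \<open>
  The question triples of the \<open>n\<close> coordinates are independent and uniform; \<open>x t\<close> is the triple of
  coordinate \<open>t\<close>. The default value \<open>(0, 0, 0)\<close> outside \<open>{..<n}\<close> makes each player's input an
  element of \<^term>\<open>bitvecs n\<close>.
\<close>

definition rep_ghz_questions :: "nat \<Rightarrow> (nat \<Rightarrow> bit3) pmf" where
  "rep_ghz_questions n = Pi_pmf {..<n} (0, 0, 0) (\<lambda>_. pmf_of_set ghz_questions)"

definition strategies :: "nat \<Rightarrow> ((nat \<Rightarrow> bit) \<Rightarrow> (nat \<Rightarrow> bit)) set" where
  "strategies n = bitvecs n \<rightarrow>\<^sub>E bitvecs n"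

definition rep_ghz_wins ::
  "nat \<Rightarrow> ((nat \<Rightarrow> bit) \<Rightarrow> (nat \<Rightarrow> bit)) \<Rightarrow> ((nat \<Rightarrow> bit) \<Rightarrow> (nat \<Rightarrow> bit)) \<Rightarrow>
    ((nat \<Rightarrow> bit) \<Rightarrow> (nat \<Rightarrow> bit)) \<Rightarrow> (nat \<Rightarrow> bit3) \<Rightarrow> bool" where
  "rep_ghz_wins n f1 f2 f3 x \<longleftrightarrow>
     (let y1 = f1 (\<lambda>t. fst (x t));
          y2 = f2 (\<lambda>t. fst (snd (x t)));
          y3 = f3 (\<lambda>t. snd (snd (x t)))
      in \<forall>t<n. ghz_wins (x t) (y1 t, y2 t, y3 t))"

definition rep_ghz_win_prob ::
  "nat \<Rightarrow> ((nat \<Rightarrow> bit) \<Rightarrow> (nat \<Rightarrow> bit)) \<Rightarrow> ((nat \<Rightarrow> bit) \<Rightarrow> (nat \<Rightarrow> bit)) \<Rightarrow>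
    ((nat \<Rightarrow> bit) \<Rightarrow> (nat \<Rightarrow> bit)) \<Rightarrow> real" where
  "rep_ghz_win_prob n f1 f2 f3 =
     measure_pmf.prob (rep_ghz_questions n) {x. rep_ghz_wins n f1 f2 f3 x}"

definition rep_ghz_value :: "nat \<Rightarrow> real" where
  "rep_ghz_value n =
     Max {rep_ghz_win_prob n f1 f2 f3 | f1 f2 f3.
            f1 \<in> strategies n \<and> f2 \<in> strategies n \<and> f3 \<in> strategies n}"

text \<open>The following lemmas show that the uniform distribution and the maximum are well defined.\<close>

lemma ghz_questions_eq: "ghz_questions = {(0, 0, 0), (0, 1, 1), (1, 0, 1), (1, 1, 0)}"
proof -
  have "x \<in> ghz_questions \<longleftrightarrow> x \<in> {(0, 0, 0), (0, 1, 1), (1, 0, 1), (1, 1, 0)}" for x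
    by (cases x; cases "fst x"; cases "fst (snd x)"; cases "snd (snd x)")
       (auto simp: ghz_questions_def)
  then show ?thesis by blast
qed

lemma finite_bitvecs: "finite (bitvecs n)"
proof -
  have "(UNIV :: bit set) = {0, 1}"
    using bit_not_zero_iff by blast
  then have "finite (UNIV :: bit set)"
    by (metis finite.emptyI finite.insertI)
  then have "finite (PiE_dflt {..<n} (0 :: bit) (\<lambda>_. UNIV))"
    by (intro finite_PiE_dflt) auto
  moreover have "PiE_dflt {..<n} 0 (\<lambda>_. UNIV) = bitvecs n"
    by (auto simp: PiE_dflt_def bitvecs_def)
  ultimately show ?thesis by simp
qed

lemma finite_strategies: "finite (strategies n)"
  unfolding strategies_def by (intro finite_PiE finite_bitvecs)

lemma strategies_nonempty: "strategies n \<noteq> {}"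
  unfolding strategies_def by (auto simp: PiE_eq_empty_iff bitvecs_def)

lemma rep_ghz_value_set:
  "{rep_ghz_win_prob n f1 f2 f3 | f1 f2 f3.
      f1 \<in> strategies n \<and> f2 \<in> strategies n \<and> f3 \<in> strategies n} =
   (\<lambda>(f1, f2, f3). rep_ghz_win_prob n f1 f2 f3) `
     (strategies n \<times> strategies n \<times> strategies n)"
  by (auto simp: image_iff, blast)

lemma rep_ghz_value_attained:
  "\<exists>f1\<in>strategies n. \<exists>f2\<in>strategies n. \<exists>f3\<in>strategies n.
     rep_ghz_value n = rep_ghz_win_prob n f1 f2 f3"
proof -
  have "rep_ghz_value n \<in> (\<lambda>(f1, f2, f3). rep_ghz_win_prob n f1 f2 f3) `
     (strategies n \<times> strategies n \<times> strategies n)"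
    unfolding rep_ghz_value_def rep_ghz_value_set
    by (intro Max_in) (auto simp: finite_strategies strategies_nonempty)
  then show ?thesis by auto
qed

lemma rep_ghz_value_upper:
  assumes "f1 \<in> strategies n" "f2 \<in> strategies n" "f3 \<in> strategies n"
  shows "rep_ghz_win_prob n f1 f2 f3 \<le> rep_ghz_value n"
  unfolding rep_ghz_value_def rep_ghz_value_set
  using assms by (intro Max_ge) (force simp: finite_strategies)+

end

theory Submission
  imports Defs "HOL-Library.Function_Algebras"
begin

text \<open>
  Replace a question \<open>x\<close> with answer \<open>y\<close> by the element \<open>2y - x\<close> of the integers modulo 4. The players
  win iff their three elements sum to zero, because \<open>x1 \<or> x2 \<or> x3\<close> is half of the integer
  \<open>x1 + x2 + x3\<close>. So the strategies become sets \<open>A, B, C\<close> of \<open>N = 2^n\<close> vectors modulo 4 that contain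
  one vector in each class modulo 2, and the value counts the pairs \<open>(a, b)\<close> with \<open>a + b \<in> C\<close>.
  As \<open>2b\<close> depends only on the class of \<open>b\<close>, and determines it, the map \<open>(a, b) \<mapsto> a + 2b\<close> is injective
  on \<open>A \<times> B\<close>. If there were many pairs, then an entropy form of the Balog-Szemeredi-Gowers and
  Pluennecke inequalities would make \<open>a + 2b\<close> concentrate on few values. Quantitatively the value
  is at most \<open>2^(-n/15)\<close>.
\<close>

section \<open>Entropy of a function on a finite set\<close>

text \<open>Shannon entropy, in natural logarithms, of \<open>f\<close> at a uniform point of
  \<open>\<Omega>\<close>. Averaging over sample points instead of values lets all later estimates
  be made fibre by fibre.\<close>

definition ent :: "'a set \<Rightarrow> ('a \<Rightarrow> 'b) \<Rightarrow> real" where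
  "ent \<Omega> f = (\<Sum>w\<in>\<Omega>. ln (card \<Omega> / card {v\<in>\<Omega>. f v = f w})) / card \<Omega>"

lemma card_fibre_pos:
  assumes "finite \<Omega>" "w \<in> \<Omega>"
  shows "card {v\<in>\<Omega>. f v = f w} > 0"
  using assms by (auto simp: card_gt_0_iff)

text \<open>The hypothesis says that \<open>g\<close> determines \<open>f\<close> on
  \<open>\<Omega>\<close>, so the fibres of \<open>g\<close> lie inside those of
  \<open>f\<close>.\<close>

lemma ent_mono:
  assumes "finite \<Omega>" "\<And>v w. v \<in> \<Omega> \<Longrightarrow> w \<in> \<Omega> \<Longrightarrow> g v = g w \<Longrightarrow> f v = f w"
  shows "ent \<Omega> f \<le> ent \<Omega> g"
  unfolding ent_def
proof (intro divide_right_mono sum_mono)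
  fix w assume w: "w \<in> \<Omega>"
  have "card {v\<in>\<Omega>. g v = g w} \<le> card {v\<in>\<Omega>. f v = f w}"
    using assms(1) by (intro card_mono) (auto intro: assms(2)[OF _ w])
  moreover have "card {v\<in>\<Omega>. f v = f w} > 0" "card {v\<in>\<Omega>. g v = g w} > 0" "card \<Omega> > 0"
    using card_fibre_pos assms(1) w by (auto simp: card_gt_0_iff)
  ultimately show "ln (card \<Omega> / card {v\<in>\<Omega>. f v = f w}) \<le> ln (card \<Omega> / card {v\<in>\<Omega>. g v = g w})"
    by (simp add: frac_le)
qed simp

lemma ent_nonneg:
  assumes "finite \<Omega>"
  shows "ent \<Omega> f \<ge> 0"
  unfolding ent_def
proof (intro divide_nonneg_nonneg sum_nonneg)
  fix w assume w: "w \<in> \<Omega>"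
  have "card {v\<in>\<Omega>. f v = f w} \<le> card \<Omega>"
    using assms by (intro card_mono) auto
  then show "0 \<le> ln (card \<Omega> / card {v\<in>\<Omega>. f v = f w})"
    using card_fibre_pos[OF assms w, of f] by simp
qed simp

lemma ent_inj:
  assumes "finite \<Omega>" "\<Omega> \<noteq> {}" "inj_on f \<Omega>"
  shows "ent \<Omega> f = ln (card \<Omega>)"
proof -
  have "{v\<in>\<Omega>. f v = f w} = {w}" if "w \<in> \<Omega>" for w
    using that assms(3) by (auto dest: inj_onD)
  then show ?thesis using assms(1,2) by (simp add: ent_def)
qed

text \<open>Every nonempty fibre contributes exactly 1.\<close>

lemma sum_inverse_card_fibre:
  assumes "finite \<Omega>"
  shows "(\<Sum>w\<in>\<Omega>. 1 / real (card {v\<in>\<Omega>. f v = f w})) = card (f ` \<Omega>)"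
proof -
  have "(\<Sum>w\<in>\<Omega>. 1 / real (card {v\<in>\<Omega>. f v = f w})) =
      (\<Sum>y\<in>f ` \<Omega>. \<Sum>w | w \<in> \<Omega> \<and> f w = y. 1 / real (card {v\<in>\<Omega>. f v = f w}))"
    using assms by (intro sum.group[symmetric]) auto
  also have "\<dots> = (\<Sum>y\<in>f ` \<Omega>. 1)"
  proof (intro sum.cong refl)
    fix y assume "y \<in> f ` \<Omega>"
    then have "card {v\<in>\<Omega>. f v = y} > 0" using assms by (auto simp: card_gt_0_iff)
    then show "(\<Sum>w | w \<in> \<Omega> \<and> f w = y. 1 / real (card {v\<in>\<Omega>. f v = f w})) = 1" by simp
  qed
  finally show ?thesis by simp
qed

text \<open>Jensen's inequality in the form \<open>ln t \<le> t - 1\<close>, applied at each point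
  to \<open>t = n / (r * m w)\<close>; the inverse fibre sizes add up to the number of values, which
  is at most \<open>r\<close>.\<close>

lemma ent_le_ln_card:
  assumes "finite \<Omega>" "\<Omega> \<noteq> {}" "f ` \<Omega> \<subseteq> R" "finite R"
  shows "ent \<Omega> f \<le> ln (card R)"
proof -
  define n r where "n = real (card \<Omega>)" and "r = real (card R)"
  define m where "m w = real (card {v\<in>\<Omega>. f v = f w})" for w
  have n: "n > 0" using assms by (simp add: n_def card_gt_0_iff)
  have r: "r > 0" using assms by (auto simp: r_def card_gt_0_iff)
  have m: "m w > 0" if "w \<in> \<Omega>" for w
    using card_fibre_pos[OF assms(1) that] by (simp add: m_def)
  have inv: "(\<Sum>w\<in>\<Omega>. 1 / m w) = card (f ` \<Omega>)"
    using sum_inverse_card_fibre[OF assms(1)] by (simp add: m_def)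
  have "(\<Sum>w\<in>\<Omega>. ln (n / m w) - ln r) \<le> (\<Sum>w\<in>\<Omega>. n / r * (1 / m w) - 1)"
  proof (intro sum_mono)
    fix w assume w: "w \<in> \<Omega>"
    have "ln (n / m w) - ln r = ln (n / r * (1 / m w))"
      using n r m[OF w] by (simp add: ln_div ln_mult)
    also have "\<dots> \<le> n / r * (1 / m w) - 1"
      using n r m[OF w] by (intro ln_le_minus_one) simp
    finally show "ln (n / m w) - ln r \<le> n / r * (1 / m w) - 1" .
  qed
  also have "\<dots> = n / r * card (f ` \<Omega>) - n"
    unfolding sum_subtractf sum_distrib_left[symmetric] inv by (simp add: n_def)
  also have "\<dots> \<le> n / r * r - n"
    using n r card_mono[OF assms(4,3)] by (intro diff_right_mono mult_left_mono) (auto simp: r_def)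
  also have "\<dots> = 0" using r by simp
  finally have "(\<Sum>w\<in>\<Omega>. ln (n / m w)) \<le> n * ln r"
    by (simp add: sum_subtractf n_def)
  then have "(\<Sum>w\<in>\<Omega>. ln (n / m w)) / n \<le> ln r" using n by (simp add: field_simps)
  then show ?thesis by (simp add: ent_def n_def m_def r_def)
qed

text \<open>Here \<open>u\<close> is determined by \<open>f\<close> and by \<open>g\<close>, and
  \<open>h\<close> by both together. This is nonnegativity of the mutual information of
  \<open>f\<close> and \<open>g\<close> given \<open>u\<close>, again by
  \<open>ln t \<le> t - 1\<close>, now at \<open>t = mf w * mg w / (mp w * mu w)\<close>, whose
  average is at most 1.\<close>

lemma ent_submodular:
  assumes fin: "finite \<Omega>"
    and uf: "\<And>v w. v \<in> \<Omega> \<Longrightarrow> w \<in> \<Omega> \<Longrightarrow> f v = f w \<Longrightarrow> u v = u w"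
    and ug: "\<And>v w. v \<in> \<Omega> \<Longrightarrow> w \<in> \<Omega> \<Longrightarrow> g v = g w \<Longrightarrow> u v = u w"
    and hfg: "\<And>v w. v \<in> \<Omega> \<Longrightarrow> w \<in> \<Omega> \<Longrightarrow> f v = f w \<Longrightarrow> g v = g w \<Longrightarrow> h v = h w"
  shows "ent \<Omega> h + ent \<Omega> u \<le> ent \<Omega> f + ent \<Omega> g"
proof (cases "\<Omega> = {}")
  case True
  then show ?thesis by (simp add: ent_def)
next
  case False
  let ?p = "\<lambda>w. (f w, g w)"
  define n where "n = real (card \<Omega>)"
  define mf where "mf w = real (card {v\<in>\<Omega>. f v = f w})" for w
  define mg where "mg w = real (card {v\<in>\<Omega>. g v = g w})" for w
  define mu where "mu w = real (card {v\<in>\<Omega>. u v = u w})" for w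
  define mp where "mp w = real (card {v\<in>\<Omega>. ?p v = ?p w})" for w
  have n: "n > 0" using fin False by (simp add: n_def card_gt_0_iff)
  have pos: "mf w > 0" "mg w > 0" "mu w > 0" "mp w > 0" if "w \<in> \<Omega>" for w
    using card_fibre_pos[OF fin that] by (simp_all only: mf_def mg_def mu_def mp_def of_nat_0_less_iff)
  have mp_le: "(\<Sum>w\<in>{w\<in>\<Omega>. f w = f v \<and> g w = g v'}. 1 / mp w) \<le> 1" for v v'
  proof (cases "{w\<in>\<Omega>. f w = f v \<and> g w = g v'} = {}")
    case True
    then show ?thesis by (simp only: sum.empty zero_le_one)
  next
    case False
    have "mp w = card {w\<in>\<Omega>. f w = f v \<and> g w = g v'}" if "w \<in> {w\<in>\<Omega>. f w = f v \<and> g w = g v'}" for w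
      using that by (simp add: mp_def)
    then show ?thesis by simp
  qed
  have mu_eq: "mu v = mu w" if "u v = u w" for v w
    using that by (simp add: mu_def)
  have mf: "mf w = card {v\<in>\<Omega>. f w = f v}" and mg: "mg w = card {v\<in>\<Omega>. g w = g v}" for w
    unfolding mf_def mg_def by (metis (mono_tags, lifting))+
  \<comment> \<open>Expanding \<open>mf w\<close> and \<open>mg w\<close> as counts of
    \<open>v\<close> and \<open>v'\<close> and summing over \<open>w\<close> first leaves, for each
    pair \<open>(v, v')\<close>, the joint fibre treated in \<open>mp_le\<close>.\<close>
  have "(\<Sum>w\<in>\<Omega>. mf w * mg w / (mp w * mu w)) =
      (\<Sum>w\<in>\<Omega>. \<Sum>v\<in>{v\<in>\<Omega>. f w = f v}. \<Sum>v'\<in>{v'\<in>\<Omega>. g w = g v'}. 1 / (mp w * mu w))"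
    by (simp add: mf mg)
  also have "\<dots> = (\<Sum>w\<in>\<Omega>. \<Sum>v\<in>{v\<in>\<Omega>. f w = f v}. \<Sum>v'\<in>\<Omega>.
      if g w = g v' then 1 / (mp w * mu w) else 0)"
    by (simp only: sum.inter_filter[OF fin])
  also have "\<dots> = (\<Sum>w\<in>\<Omega>. \<Sum>v\<in>\<Omega>. \<Sum>v'\<in>\<Omega>.
      if f w = f v \<and> g w = g v' then 1 / (mp w * mu w) else 0)"
    by (simp only: sum.inter_filter[OF fin]) (intro sum.cong refl, auto)
  also have "\<dots> = (\<Sum>v\<in>\<Omega>. \<Sum>v'\<in>\<Omega>. \<Sum>w\<in>\<Omega>.
      if f w = f v \<and> g w = g v' then 1 / (mp w * mu w) else 0)"
    by (subst sum.swap) (intro sum.cong refl sum.swap)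
  also have "\<dots> \<le> (\<Sum>v\<in>\<Omega>. \<Sum>v'\<in>\<Omega>. if u v' = u v then 1 / mu v else 0)"
  proof (intro sum_mono)
    fix v v' assume v: "v \<in> \<Omega>" "v' \<in> \<Omega>"
    have "(\<Sum>w\<in>\<Omega>. if f w = f v \<and> g w = g v' then 1 / (mp w * mu w) else 0) =
        (\<Sum>w\<in>{w\<in>\<Omega>. f w = f v \<and> g w = g v'}. 1 / (mp w * mu w))"
      by (simp only: sum.inter_filter[OF fin])
    also have "\<dots> = (\<Sum>w\<in>{w\<in>\<Omega>. f w = f v \<and> g w = g v'}. 1 / mp w * (1 / mu v))"
    proof (intro sum.cong refl)
      fix w assume "w \<in> {w\<in>\<Omega>. f w = f v \<and> g w = g v'}"
      then have "mu w = mu v" using v by (intro mu_eq uf) auto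
      then show "1 / (mp w * mu w) = 1 / mp w * (1 / mu v)" by simp
    qed
    also have "\<dots> = (\<Sum>w\<in>{w\<in>\<Omega>. f w = f v \<and> g w = g v'}. 1 / mp w) * (1 / mu v)"
      by (rule sum_distrib_right[symmetric])
    \<comment> \<open>A point \<open>w\<close> with \<open>f w = f v\<close> and
      \<open>g w = g v'\<close> forces \<open>u v = u w = u v'\<close>, so the other pairs
      contribute nothing.\<close>
    also have "\<dots> \<le> (if u v' = u v then 1 / mu v else 0)"
    proof (cases "u v' = u v")
      case True
      then show ?thesis
        using mult_right_mono[OF mp_le[of v v'], of "1 / mu v"] pos(3)[OF v(1)] by simp
    next
      case False
      then have "{w\<in>\<Omega>. f w = f v \<and> g w = g v'} = {}" using v by (metis (mono_tags, lifting) empty_Collect_eq uf ug)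
      then show ?thesis using False by (simp only: sum.empty) simp
    qed
    finally show "(\<Sum>w\<in>\<Omega>. if f w = f v \<and> g w = g v' then 1 / (mp w * mu w) else 0)
      \<le> (if u v' = u v then 1 / mu v else 0)" .
  qed
  also have "\<dots> = (\<Sum>v\<in>\<Omega>. 1)"
  proof (intro sum.cong refl)
    fix v assume v: "v \<in> \<Omega>"
    have "(\<Sum>v'\<in>\<Omega>. if u v' = u v then 1 / mu v else 0) = (\<Sum>v'\<in>{v'\<in>\<Omega>. u v' = u v}. 1 / mu v)"
      by (simp only: sum.inter_filter[OF fin])
    also have "\<dots> = mu v * (1 / mu v)" by (simp add: mu_def)
    also have "\<dots> = 1" using pos(3)[OF v] by simp
    finally show "(\<Sum>v'\<in>\<Omega>. if u v' = u v then 1 / mu v else 0) = 1" .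
  qed
  finally have key: "(\<Sum>w\<in>\<Omega>. mf w * mg w / (mp w * mu w)) \<le> n" by (simp add: n_def)
  have "(\<Sum>w\<in>\<Omega>. ln (n / mp w) + ln (n / mu w) - ln (n / mf w) - ln (n / mg w))
      \<le> (\<Sum>w\<in>\<Omega>. mf w * mg w / (mp w * mu w) - 1)"
  proof (intro sum_mono)
    fix w assume w: "w \<in> \<Omega>"
    have "ln (n / mp w) + ln (n / mu w) - ln (n / mf w) - ln (n / mg w)
        = ln (mf w * mg w / (mp w * mu w))"
      using n pos[OF w] by (simp add: ln_div ln_mult)
    also have "\<dots> \<le> mf w * mg w / (mp w * mu w) - 1"
      using pos[OF w] by (intro ln_le_minus_one) simp
    finally show "ln (n / mp w) + ln (n / mu w) - ln (n / mf w) - ln (n / mg w)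
      \<le> mf w * mg w / (mp w * mu w) - 1" .
  qed
  also have "\<dots> \<le> 0" using key by (simp add: sum_subtractf n_def)
  finally have "(\<Sum>w\<in>\<Omega>. ln (n / mp w)) + (\<Sum>w\<in>\<Omega>. ln (n / mu w))
      \<le> (\<Sum>w\<in>\<Omega>. ln (n / mf w)) + (\<Sum>w\<in>\<Omega>. ln (n / mg w))"
    by (simp add: sum_subtractf sum.distrib)
  then have "((\<Sum>w\<in>\<Omega>. ln (n / mp w)) + (\<Sum>w\<in>\<Omega>. ln (n / mu w))) / n
      \<le> ((\<Sum>w\<in>\<Omega>. ln (n / mf w)) + (\<Sum>w\<in>\<Omega>. ln (n / mg w))) / n"
    using n by (intro divide_right_mono) auto
  then have "ent \<Omega> ?p + ent \<Omega> u \<le> ent \<Omega> f + ent \<Omega> g"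
    by (simp only: ent_def add_divide_distrib n_def mp_def mu_def mf_def mg_def)
  moreover have "ent \<Omega> h \<le> ent \<Omega> ?p"
    by (intro ent_mono[OF fin] hfg) auto
  ultimately show ?thesis by linarith
qed

text \<open>Submodularity with a constant as the common part.\<close>

lemma ent_subadditive:
  assumes "finite \<Omega>"
    and "\<And>v w. v \<in> \<Omega> \<Longrightarrow> w \<in> \<Omega> \<Longrightarrow> f v = f w \<Longrightarrow> g v = g w \<Longrightarrow> h v = h w"
  shows "ent \<Omega> h \<le> ent \<Omega> f + ent \<Omega> g"
proof -
  have "ent \<Omega> h + ent \<Omega> (\<lambda>_. ()) \<le> ent \<Omega> f + ent \<Omega> g"
  proof (rule ent_submodular[OF assms(1)])
    show "h v = h w" if "v \<in> \<Omega>" "w \<in> \<Omega>" "f v = f w" "g v = g w" for v w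
      using that by (rule assms(2))
  qed auto
  then show ?thesis using ent_nonneg[OF assms(1), of "\<lambda>_. ()"] by linarith
qed

section \<open>Additive triples\<close>

text \<open>Convexity of the cube: \<open>d ^ 3\<close> lies above its tangent at \<open>m\<close>
  because the difference is \<open>(d - m)\<^sup>2 * (d + 2 * m)\<close>.\<close>

lemma cube_of_sum_le:
  fixes d :: "'a \<Rightarrow> real"
  assumes "finite C" "card C \<le> N" "N > 0" "\<And>c. c \<in> C \<Longrightarrow> d c \<ge> 0"
  shows "(\<Sum>c\<in>C. d c) ^ 3 \<le> real N ^ 2 * (\<Sum>c\<in>C. d c ^ 3)"
proof -
  \<comment> \<open>The mean is taken over \<open>N\<close> places, as if \<open>d\<close> were
    padded with zeros when \<open>C\<close> has fewer than \<open>N\<close> elements.\<close>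
  define m where "m = (\<Sum>c\<in>C. d c) / N"
  have m: "m \<ge> 0" using assms by (auto simp: m_def intro!: sum_nonneg divide_nonneg_nonneg)
  have s: "(\<Sum>c\<in>C. d c) = m * N" using assms by (simp add: m_def)
  have "m ^ 3 * N \<le> 3 * m ^ 2 * (m * N) - 2 * m ^ 3 * card C"
  proof -
    have "m ^ 3 * card C \<le> m ^ 3 * N"
      using m assms(2) by (intro mult_left_mono) auto
    then show ?thesis by (simp add: power2_eq_square power3_eq_cube)
  qed
  also have "\<dots> = (\<Sum>c\<in>C. 3 * m ^ 2 * d c - 2 * m ^ 3)"
    by (simp add: sum_subtractf s flip: sum_distrib_left)
  also have "\<dots> \<le> (\<Sum>c\<in>C. d c ^ 3)"
  proof (intro sum_mono)
    fix c assume "c \<in> C"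
    then have "0 \<le> (d c - m)\<^sup>2 * (d c + 2 * m)"
      using m assms(4) by (intro mult_nonneg_nonneg) auto
    also have "\<dots> = d c ^ 3 - (3 * m ^ 2 * d c - 2 * m ^ 3)" by algebra
    finally show "3 * m ^ 2 * d c - 2 * m ^ 3 \<le> d c ^ 3" by simp
  qed
  finally have "real N ^ 2 * (m ^ 3 * N) \<le> real N ^ 2 * (\<Sum>c\<in>C. d c ^ 3)"
    by (intro mult_left_mono) auto
  then show ?thesis by (simp add: s power_mult_distrib power2_eq_square power3_eq_cube algebra_simps)
qed

text \<open>The argument shows that \<open>N ^ 2 / card T\<close> is at least the 15th root of
  \<open>N\<close>. Many pairs in \<open>T\<close> would give a random point of large entropy, while
  \<open>inj\<close> lets that point be recovered from data of small entropy.\<close>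

theorem additive_triples_bound:
  fixes A B C :: "'g::ab_group_add set"
  assumes fin: "finite A" "finite B" "finite C"
    and card: "card A \<le> N" "card B \<le> N" "card C \<le> N"
    and inj: "inj_on (\<lambda>(x, y). x + y + y) (A \<times> B)"
    and T_def: "T = {(a, b) \<in> A \<times> B. a + b \<in> C}"
  shows "card T ^ 15 \<le> N ^ 29"
proof (cases "T = {}")
  case True
  then show ?thesis by simp
next
  case False
  have finT: "finite T"
    unfolding T_def using fin by (auto intro: finite_subset[of _ "A \<times> B"])
  then have Tpos: "card T > 0" using False by (simp add: card_gt_0_iff)
  have N: "N > 0" using False card fin by (auto simp: T_def card_gt_0_iff intro!: Nat.gr0I)
  define Q where "Q c = {a\<in>A. c - a \<in> B}" for c
  have finQ: "finite (Q c)" for c using fin by (simp add: Q_def)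
  \<comment> \<open>Under the uniform distribution on \<open>\<Omega>\<close> the three pairs \<open>(ai, bi)\<close> with sum \<open>c\<close> are independent given \<open>c\<close>.\<close>
  define \<Omega> where "\<Omega> = (SIGMA c:C. Q c \<times> Q c \<times> Q c)"
  have fin\<Omega>: "finite \<Omega>" using fin finQ by (simp add: \<Omega>_def)
  have card\<Omega>: "card \<Omega> = (\<Sum>c\<in>C. card (Q c) ^ 3)"
    using fin finQ by (simp add: \<Omega>_def card_cartesian_product power3_eq_cube mult.assoc)
  have "card T = card (SIGMA c:C. Q c)"
    by (rule bij_betw_same_card[of "\<lambda>(a, b). (a + b, a)"],
        rule bij_betw_byWitness[where f' = "\<lambda>(c, a). (a, c - a)"])
      (auto simp: T_def Q_def)
  then have cardT: "card T = (\<Sum>c\<in>C. card (Q c))"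
    using fin finQ by simp
  have T\<Omega>: "real (card T) ^ 3 \<le> real N ^ 2 * card \<Omega>"
    using cube_of_sum_le[of C N "\<lambda>c. real (card (Q c))"] fin card N by (simp add: cardT card\<Omega>)
  then have \<Omega>0: "\<Omega> \<noteq> {}" using Tpos by (auto simp: zero_less_power)
  then have \<Omega>pos: "card \<Omega> > 0" using fin\<Omega> by (simp add: card_gt_0_iff)

  \<comment> \<open>\<open>e\<close> is the logarithmic deficit of \<open>T\<close> against the
    trivial bound \<open>N ^ 2\<close>; the aim is \<open>L \<le> 15 * e\<close>.\<close>
  define L e where "L = ln (real N)" and "e = 2 * L - ln (real (card T))"
  have "ln (real (card T) ^ 3) \<le> ln (real N ^ 2 * card \<Omega>)"
    using T\<Omega> Tpos N \<Omega>pos by simp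
  then have \<Omega>_ge: "ln (card \<Omega>) \<ge> 4 * L - 3 * e"
    using Tpos N \<Omega>pos by (simp add: ln_mult ln_realpow L_def e_def)

  define c where "c = (\<lambda>(c::'g, a1::'g, a2::'g, a3::'g). c)"
  define a1 where "a1 = (\<lambda>(c::'g, a1::'g, a2::'g, a3::'g). a1)"
  define a2 where "a2 = (\<lambda>(c::'g, a1::'g, a2::'g, a3::'g). a2)"
  define a3 where "a3 = (\<lambda>(c::'g, a1::'g, a2::'g, a3::'g). a3)"
  note proj = c_def a1_def a2_def a3_def
  have memb: "c w \<in> C" "a1 w \<in> A" "a2 w \<in> A" "a3 w \<in> A"
      "c w - a1 w \<in> B" "c w - a2 w \<in> B" "c w - a3 w \<in> B" if "w \<in> \<Omega>" for w
    using that by (auto simp: \<Omega>_def Q_def proj)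
  have eqI: "v = w" if "c v = c w" "a1 v = a1 w" "a2 v = a2 w" "a3 v = a3 w" for v w
    using that by (auto simp: proj split: prod.splits)
  have ent1: "ent \<Omega> f \<le> L" if "f ` \<Omega> \<subseteq> S" "finite S" "card S \<le> N" for f :: "_ \<Rightarrow> 'g" and S
  proof -
    have "card S > 0" using that \<Omega>0 by (auto simp: card_gt_0_iff)
    then have "ln (card S) \<le> L" using that N by (simp add: L_def)
    then show ?thesis using ent_le_ln_card[OF fin\<Omega> \<Omega>0 that(1,2)] by linarith
  qed
  have ec: "ent \<Omega> c \<le> L" using memb fin card by (intro ent1[of c C]) auto
  have ea: "ent \<Omega> a1 \<le> L" "ent \<Omega> a2 \<le> L" "ent \<Omega> a3 \<le> L"
    using memb fin card by (auto intro!: ent1[of _ A])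
  have eb: "ent \<Omega> (\<lambda>w. c w - a1 w) \<le> L" "ent \<Omega> (\<lambda>w. c w - a2 w) \<le> L" "ent \<Omega> (\<lambda>w. c w - a3 w) \<le> L"
    using memb fin card by (auto intro!: ent1[of _ B])
  have eid: "ent \<Omega> (\<lambda>w. w) \<ge> 4 * L - 3 * e"
    using \<Omega>_ge ent_inj[OF fin\<Omega> \<Omega>0, of "\<lambda>w. w"] by simp

  \<comment> \<open>Writing \<open>b = c - a\<close>, the difference of two \<open>a\<close>'s over the same \<open>c\<close> is also a difference of two \<open>b\<close>'s.\<close>
  have diff: "ent \<Omega> (\<lambda>w. x w - y w) \<le> L + 3 * e"
    if x: "ent \<Omega> x \<le> L" "ent \<Omega> (\<lambda>w. c w - x w) \<le> L"
      and y: "ent \<Omega> y \<le> L" "ent \<Omega> (\<lambda>w. c w - y w) \<le> L"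
      and z: "ent \<Omega> z \<le> L"
      and dt: "\<And>v w. c v = c w \<Longrightarrow> x v = x w \<Longrightarrow> y v = y w \<Longrightarrow> z v = z w \<Longrightarrow> v = w"
    for x y z :: "_ \<Rightarrow> 'g"
  proof -
    let ?xy = "\<lambda>w. (x w, y w)" and ?b = "\<lambda>w. (c w - x w, c w - y w)" and ?h = "\<lambda>w. (c w, x w, y w)"
    have "ent \<Omega> ?h + ent \<Omega> (\<lambda>w. x w - y w) \<le> ent \<Omega> ?xy + ent \<Omega> ?b"
    proof (intro ent_submodular[OF fin\<Omega>])
      fix v w assume "?b v = ?b w"
      then have "(c v - y v) - (c v - x v) = (c w - y w) - (c w - x w)" by simp
      then show "x v - y v = x w - y w" by simp
    qed auto
    moreover have "ent \<Omega> ?xy \<le> ent \<Omega> x + ent \<Omega> y"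
      by (intro ent_subadditive[OF fin\<Omega>]) auto
    moreover have "ent \<Omega> ?b \<le> ent \<Omega> (\<lambda>w. c w - x w) + ent \<Omega> (\<lambda>w. c w - y w)"
      by (intro ent_subadditive[OF fin\<Omega>]) auto
    \<comment> \<open>Adjoining \<open>z\<close> recovers the whole sample point, so
      \<open>?h\<close> has entropy at least \<open>3 * L - 3 * e\<close>.\<close>
    moreover have "ent \<Omega> (\<lambda>w. w) \<le> ent \<Omega> ?h + ent \<Omega> z"
      by (rule ent_subadditive[OF fin\<Omega>]) (rule dt; simp)
    ultimately show ?thesis using x y z eid by linarith
  qed
  have d12: "ent \<Omega> (\<lambda>w. a1 w - a2 w) \<le> L + 3 * e"
    by (rule diff[OF ea(1) eb(1) ea(2) eb(2) ea(3)]) (rule eqI)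
  have d13: "ent \<Omega> (\<lambda>w. a1 w - a3 w) \<le> L + 3 * e"
    by (rule diff[OF ea(1) eb(1) ea(3) eb(3) ea(2)]) (rule eqI)
  have d32: "ent \<Omega> (\<lambda>w. a3 w - a2 w) \<le> L + 3 * e"
    by (rule diff[OF ea(3) eb(3) ea(2) eb(2) ea(1)]) (rule eqI)

  \<comment> \<open>With \<open>a1 + b2 = a1 - a2 + c\<close> of small entropy given \<open>c\<close>, the sum \<open>a1 + b2 + b3\<close> can be formed by
    adding either \<open>b3\<close> to \<open>a1 + b2\<close> or \<open>b2\<close> to \<open>a1 + b3\<close>.\<close>
  let ?S = "\<lambda>w. (c w, a1 w + (c w - a2 w) + (c w - a3 w))"
  have S: "ent \<Omega> ?S \<le> 2 * L + 9 * e"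
  proof -
    let ?f = "\<lambda>w. (c w, a1 w - a2 w, c w - a3 w)" and ?g = "\<lambda>w. (c w, a1 w - a3 w, c w - a2 w)"
    have "ent \<Omega> (\<lambda>w. w) + ent \<Omega> ?S \<le> ent \<Omega> ?f + ent \<Omega> ?g"
    proof (intro ent_submodular[OF fin\<Omega>])
      fix v w assume "?f v = ?f w"
      then have *: "c v = c w" "a1 v - a2 v = a1 w - a2 w" "a3 v = a3 w" by auto
      have "a1 v + (c v - a2 v) + (c v - a3 v) = (a1 v - a2 v) + c v + (c v - a3 v)" by simp
      also have "\<dots> = (a1 w - a2 w) + c w + (c w - a3 w)" by (simp only: *)
      also have "\<dots> = a1 w + (c w - a2 w) + (c w - a3 w)" by simp
      finally show "?S v = ?S w" using * by simp
    next
      fix v w assume "?g v = ?g w"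
      then have *: "c v = c w" "a1 v - a3 v = a1 w - a3 w" "a2 v = a2 w" by auto
      have "a1 v + (c v - a2 v) + (c v - a3 v) = (a1 v - a3 v) + c v + (c v - a2 v)" by simp
      also have "\<dots> = (a1 w - a3 w) + c w + (c w - a2 w)" by (simp only: *)
      also have "\<dots> = a1 w + (c w - a2 w) + (c w - a3 w)" by simp
      finally show "?S v = ?S w" using * by simp
    next
      fix v w assume "?f v = ?f w" "?g v = ?g w"
      then show "v = w" by (intro eqI) auto
    qed
    moreover have "ent \<Omega> ?f \<le> ent \<Omega> c + ent \<Omega> (\<lambda>w. (a1 w - a2 w, c w - a3 w))"
      by (intro ent_subadditive[OF fin\<Omega>]) auto
    moreover have "ent \<Omega> (\<lambda>w. (a1 w - a2 w, c w - a3 w))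
        \<le> ent \<Omega> (\<lambda>w. a1 w - a2 w) + ent \<Omega> (\<lambda>w. c w - a3 w)"
      by (intro ent_subadditive[OF fin\<Omega>]) auto
    moreover have "ent \<Omega> ?g \<le> ent \<Omega> c + ent \<Omega> (\<lambda>w. (a1 w - a3 w, c w - a2 w))"
      by (intro ent_subadditive[OF fin\<Omega>]) auto
    moreover have "ent \<Omega> (\<lambda>w. (a1 w - a3 w, c w - a2 w))
        \<le> ent \<Omega> (\<lambda>w. a1 w - a3 w) + ent \<Omega> (\<lambda>w. c w - a2 w)"
      by (intro ent_subadditive[OF fin\<Omega>]) auto
    ultimately show ?thesis using eid ec eb d12 d13 by linarith
  qed
  have "ent \<Omega> (\<lambda>w. w) \<le> ent \<Omega> ?S + ent \<Omega> (\<lambda>w. a3 w - a2 w)"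
  proof (intro ent_subadditive[OF fin\<Omega>])
    fix v w assume vw: "v \<in> \<Omega>" "w \<in> \<Omega>" and s: "?S v = ?S w" and d: "a3 v - a2 v = a3 w - a2 w"
    \<comment> \<open>\<open>a1 + 2 b2 = (a1 + b2 + b3) + (b2 - b3)\<close>\<close>
    have double: "a1 w + (c w - a2 w) + (c w - a2 w) =
        (a1 w + (c w - a2 w) + (c w - a3 w)) + (a3 w - a2 w)" for w by simp
    have "c v = c w \<and> a1 v + (c v - a2 v) + (c v - a3 v) = a1 w + (c w - a2 w) + (c w - a3 w)"
      using s unfolding prod.inject .
    then have c: "c v = c w"
      and s': "a1 v + (c v - a2 v) + (c v - a3 v) = a1 w + (c w - a2 w) + (c w - a3 w)"
      by blast+
    have "a1 v + (c v - a2 v) + (c v - a2 v) = a1 w + (c w - a2 w) + (c w - a2 w)"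
      by (simp only: double s' d)
    then have "(a1 v, c v - a2 v) = (a1 w, c w - a2 w)"
      using memb vw by (intro inj_onD[OF inj]) auto
    then have "a1 v = a1 w" "a2 v = a2 w" using c by simp_all
    moreover from this have "a3 v = a3 w" using d by simp
    ultimately show "v = w" using c by (intro eqI)
  qed
  \<comment> \<open>The bounds combine to
    \<open>4 * L - 3 * e \<le> (2 * L + 9 * e) + (L + 3 * e)\<close>.\<close>
  then have "L \<le> 15 * e" using S d32 eid by linarith
  then have "ln (real (card T) ^ 15) \<le> ln (real N ^ 29)"
    using Tpos N by (simp add: ln_realpow L_def e_def)
  then have "real (card T) ^ 15 \<le> real N ^ 29"
    using Tpos N by (subst (asm) ln_le_cancel_iff) auto
  then show ?thesis by (simp flip: of_nat_power)
qed

section \<open>The game over the integers modulo 4\<close>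

text \<open>The representative 0 or 1 in the integers modulo 4. It is not additive, and the carry it
  produces is what encodes the disjunction of the questions.\<close>

definition lift :: "bit \<Rightarrow> 4" where
  "lift b = of_bool (b = 1)"

definition lift_answer :: "((nat \<Rightarrow> bit) \<Rightarrow> (nat \<Rightarrow> bit)) \<Rightarrow> (nat \<Rightarrow> bit) \<Rightarrow> nat \<Rightarrow> 4" where
  "lift_answer f p = (\<lambda>t. 2 * lift (f p t) - lift (p t))"

lemma four_eq_0: "(4::4) = 0"
  by simp

lemma double_lift_inj:
  assumes "2 * lift a = 2 * lift b"
  shows "a = b"
proof -
  have "(2::4) \<noteq> 0" by simp
  then have "a = 1 \<longleftrightarrow> b = 1" using assms by (auto simp: lift_def of_bool_def split: if_splits)
  then show ?thesis by (metis bit_not_one_iff)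
qed

text \<open>Doubling kills the answer, since \<open>4 = 0\<close>, and \<open>-2 = 2\<close> removes
  the sign of the question.\<close>

lemma double_lift_answer: "2 * lift_answer f p t = 2 * lift (p t)"
proof -
  have "2 * lift_answer f p t = 4 * lift (f p t) - 4 * lift (p t) + 2 * lift (p t)"
    by (simp add: lift_answer_def algebra_simps)
  then show ?thesis by (simp only: four_eq_0) simp
qed

text \<open>Only the direction from winning to zero sum is stated; an upper bound on the value needs
  no more.\<close>

lemma ghz_wins_lift:
  assumes "x1 + x2 + x3 = 0" "ghz_wins (x1, x2, x3) (y1, y2, y3)"
  shows "(2 * lift y1 - lift x1) + (2 * lift y2 - lift x2) + (2 * lift y3 - lift x3) = 0"
  using assms
  by (cases x1; cases x2; cases x3; cases y1; cases y2; cases y3) (auto simp: ghz_wins_def lift_def)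

text \<open>Doubling the sum kills the second summand modulo 4 and reveals \<open>p\<close>. Then
  \<open>lift_answer f p\<close> is known, and subtracting it reveals \<open>q\<close>.\<close>

lemma inj_lift_answer_add_double:
  "inj_on (\<lambda>(x, y). x + y + y) (range (lift_answer f) \<times> range (lift_answer g))"
proof (rule inj_onI, clarify)
  fix p q p' q'
  assume eq: "lift_answer f p + lift_answer g q + lift_answer g q =
    lift_answer f p' + lift_answer g q' + lift_answer g q'"
  have at: "lift_answer f p t + 2 * lift (q t) = lift_answer f p' t + 2 * lift (q' t)" for t
  proof -
    have "lift_answer f p t + 2 * lift_answer g q t = lift_answer f p' t + 2 * lift_answer g q' t"
      using fun_cong[OF eq, of t] by (simp add: add.assoc)
    then show ?thesis by (simp only: double_lift_answer)
  qed
  have "2 * lift (p t) = 2 * lift (p' t)" for t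
  proof -
    have "2 * lift_answer f p t + 4 * lift (q t) = 2 * (lift_answer f p t + 2 * lift (q t))"
      by (simp add: algebra_simps)
    also have "\<dots> = 2 * lift_answer f p' t + 4 * lift (q' t)"
      unfolding at by (simp add: algebra_simps)
    finally show ?thesis by (simp only: four_eq_0 double_lift_answer mult_zero_left add_0_right)
  qed
  then have p: "p = p'" by (blast intro: double_lift_inj)
  have "2 * lift (q t) = 2 * lift (q' t)" for t using at[of t] p by simp
  then have "q = q'" by (blast intro: double_lift_inj)
  with p show "lift_answer f p = lift_answer f p' \<and> lift_answer g q = lift_answer g q'" by simp
qed

lemma lift_answer_inj:
  assumes "lift_answer f p = lift_answer f p'"
  shows "p = p'"
proof
  fix t
  have "2 * lift_answer f p t = 2 * lift_answer f p' t" using assms by simp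
  then show "p t = p' t" unfolding double_lift_answer by (rule double_lift_inj)
qed

section \<open>Counting winning questions and the final estimate\<close>

lemma card_bitvecs: "card (bitvecs n) = 2 ^ n"
proof -
  have UNIV_bit: "(UNIV :: bit set) = {0, 1}"
    using bit_not_zero_iff by blast
  have "bitvecs n = PiE_dflt {..<n} 0 (\<lambda>_. UNIV)"
    by (auto simp: PiE_dflt_def bitvecs_def)
  then have "card (bitvecs n) = (\<Prod>t<n. card (UNIV :: bit set))"
    by (simp add: card_PiE_dflt UNIV_bit)
  then show ?thesis by (simp add: UNIV_bit numeral_2_eq_2)
qed

text \<open>With \<open>N = 2 ^ n\<close>, there are \<open>N ^ 2\<close> question vectors, and the
  winning ones inject into the additive pairs \<open>T\<close>. The saving of \<open>N ^ 29\<close>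
  against \<open>N ^ 30\<close> is the factor \<open>2 ^ n\<close>.\<close>

lemma rep_ghz_win_prob_bound:
  assumes f: "f1 \<in> strategies n" "f2 \<in> strategies n" "f3 \<in> strategies n"
  shows "rep_ghz_win_prob n f1 f2 f3 ^ 15 * 2 ^ n \<le> 1"
proof -
  define X where "X = PiE_dflt {..<n} (0, 0, 0) (\<lambda>_. ghz_questions)"
  define W where "W = {x\<in>X. rep_ghz_wins n f1 f2 f3 x}"
  have Q: "finite ghz_questions" "ghz_questions \<noteq> {}" "card ghz_questions = 4"
    by (simp_all add: ghz_questions_eq)
  have finX: "finite X" unfolding X_def using Q by (intro finite_PiE_dflt) auto
  have cardX: "card X = 4 ^ n" unfolding X_def by (subst card_PiE_dflt) (auto simp: Q)
  have X0: "X \<noteq> {}" using cardX by auto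
  have "rep_ghz_questions n = pmf_of_set X"
    unfolding rep_ghz_questions_def X_def using Q by (intro Pi_pmf_of_set) auto
  then have prob: "rep_ghz_win_prob n f1 f2 f3 = card W / 4 ^ n"
    using measure_pmf_of_set[OF X0 finX]
    by (simp add: rep_ghz_win_prob_def cardX W_def Int_def)

  define A where "A = lift_answer f1 ` bitvecs n"
  define B where "B = lift_answer f2 ` bitvecs n"
  \<comment> \<open>The sign turns the zero-sum condition into \<open>a + b \<in> C\<close>.\<close>
  define C where "C = (\<lambda>r. - lift_answer f3 r) ` bitvecs n"
  define T where "T = {(a, b) \<in> A \<times> B. a + b \<in> C}"
  have fin: "finite A" "finite B" "finite C"
    by (simp_all add: A_def B_def C_def finite_bitvecs)
  have card: "card A \<le> 2 ^ n" "card B \<le> 2 ^ n" "card C \<le> 2 ^ n"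
    unfolding A_def B_def C_def card_bitvecs[symmetric] by (intro card_image_le finite_bitvecs)+
  have inj: "inj_on (\<lambda>(x, y). x + y + y) (A \<times> B)"
    by (rule inj_on_subset[OF inj_lift_answer_add_double[of f1 f2]]) (auto simp: A_def B_def)
  have T: "card T ^ 15 \<le> (2 ^ n) ^ 29"
    by (rule additive_triples_bound[OF fin card inj T_def])

  let ?x1 = "\<lambda>x t. fst (x t)" and ?x2 = "\<lambda>x t. fst (snd (x t))" and ?x3 = "\<lambda>x t. snd (snd (x t))"
  let ?\<phi> = "\<lambda>x :: nat \<Rightarrow> bit3. (lift_answer f1 (?x1 x), lift_answer f2 (?x2 x))"
  have sum0: "?x1 x t + ?x2 x t + ?x3 x t = 0" if "x \<in> X" for x t
    using that by (cases "t < n") (auto simp: X_def PiE_dflt_def ghz_questions_def split_beta)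
  have "inj_on ?\<phi> W"
  proof (rule inj_onI)
    fix x x' assume x: "x \<in> W" "x' \<in> W" and "?\<phi> x = ?\<phi> x'"
    then have "?x1 x = ?x1 x'" "?x2 x = ?x2 x'" by (auto dest: lift_answer_inj)
    then have 12: "?x1 x t = ?x1 x' t" "?x2 x t = ?x2 x' t" for t by metis+
    have "?x1 x t + ?x2 x t + ?x3 x t = ?x1 x' t + ?x2 x' t + ?x3 x' t" for t
      using sum0 x by (simp add: W_def)
    then have "?x3 x t = ?x3 x' t" for t using 12 by (metis add_left_cancel)
    with 12 show "x = x'" by (intro ext prod_eqI)
  qed
  moreover have "?\<phi> ` W \<subseteq> T"
  proof (intro image_subsetI)
    fix x assume x: "x \<in> W"
    then have mem: "?x1 x \<in> bitvecs n" "?x2 x \<in> bitvecs n" "?x3 x \<in> bitvecs n"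
      by (auto simp: W_def X_def PiE_dflt_def bitvecs_def)
    have out: "f1 (?x1 x) \<in> bitvecs n" "f2 (?x2 x) \<in> bitvecs n" "f3 (?x3 x) \<in> bitvecs n"
      using f mem unfolding strategies_def by auto
    have "lift_answer f1 (?x1 x) t + lift_answer f2 (?x2 x) t + lift_answer f3 (?x3 x) t = 0" for t
    proof (cases "t < n")
      case True
      then have "ghz_wins (?x1 x t, ?x2 x t, ?x3 x t) (f1 (?x1 x) t, f2 (?x2 x) t, f3 (?x3 x) t)"
        using x by (simp add: W_def rep_ghz_wins_def)
      then show ?thesis
        using sum0 x unfolding lift_answer_def by (intro ghz_wins_lift) (auto simp: W_def)
    next
      case False
      then show ?thesis using mem out by (simp add: lift_answer_def lift_def bitvecs_def)
    qed
    then have "lift_answer f1 (?x1 x) + lift_answer f2 (?x2 x) = - lift_answer f3 (?x3 x)"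
      by (auto simp: fun_eq_iff eq_neg_iff_add_eq_0)
    then show "?\<phi> x \<in> T" using mem by (auto simp: T_def A_def B_def C_def)
  qed
  moreover have "finite T"
    by (rule finite_subset[of _ "A \<times> B"]) (auto simp: T_def fin)
  ultimately have "card W \<le> card T" by (rule card_inj_on_le)
  then have "card W ^ 15 \<le> card T ^ 15" by (rule power_mono) simp
  then have "card W ^ 15 \<le> (2 ^ n) ^ 29" using T by (rule order_trans)
  then have "real (card W ^ 15) \<le> real ((2 ^ n) ^ 29)"
    by (simp only: of_nat_le_iff)
  then have "real (card W) ^ 15 * 2 ^ n \<le> (2 ^ n) ^ 29 * 2 ^ n"
    by (intro mult_right_mono) (simp_all only: of_nat_power of_nat_numeral zero_le_power zero_le_numeral)
  also have "\<dots> = (2 ^ n) ^ 30"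
    using power_Suc2[of "2 ^ n :: real" 29] by simp
  also have "\<dots> = ((2 ^ n)\<^sup>2) ^ 15"
    using power_mult[of "2 ^ n :: real" 2 15] by simp
  also have "(2 ^ n)\<^sup>2 = (4::real) ^ n"
    by (simp add: power2_eq_square flip: power_mult_distrib)
  finally show ?thesis by (simp add: prob power_divide)
qed

theorem theorem8p1:
  shows "\<exists>c::real. \<exists>C::real. c > 0 \<and> C > 0 \<and>
    (\<forall>n::nat. n > 0 \<longrightarrow> rep_ghz_value n \<le> C * real n powr (- c))"
proof (intro exI conjI allI impI)
  fix n :: nat assume n: "n > 0"
  obtain f1 f2 f3 where f: "f1 \<in> strategies n" "f2 \<in> strategies n" "f3 \<in> strategies n"
    and v: "rep_ghz_value n = rep_ghz_win_prob n f1 f2 f3"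
    using rep_ghz_value_attained[of n] by blast
  let ?v = "rep_ghz_value n"
  have v0: "?v \<ge> 0" unfolding v rep_ghz_win_prob_def by simp
  \<comment> \<open>The exponential bound is weakened by \<open>n \<le> 2 ^ n\<close> to a
    polynomial one, which yields the witnesses \<open>c = 1 / 15\<close> and
    \<open>C = 1\<close>.\<close>
  have "?v ^ 15 * real n \<le> ?v ^ 15 * 2 ^ n"
    using v0 by (intro mult_left_mono) (auto intro: less_imp_le of_nat_less_two_power)
  also have "\<dots> \<le> 1" unfolding v by (rule rep_ghz_win_prob_bound[OF f])
  finally have "?v ^ 15 \<le> real n powr (- 1)"
    using n by (simp add: powr_minus field_simps)
  also have "\<dots> = (real n powr (- (1 / 15))) ^ 15"
    using n by (simp add: powr_realpow[symmetric] powr_powr)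
  finally show "?v \<le> 1 * real n powr (- (1 / 15))"
    using power_mono_iff[of ?v "real n powr (- (1 / 15))" 15] v0 by simp
qed auto

end
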